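(* Let $n\in\mathbb{N}$ and $N=2^n$, let $u,v\in PL(n)$ be arbitrary and $\mathbf{u}=\mathcal{I}_nu$, $\mathbf{v}=\mathcal{J}_nv\in\mathbb{R}^N$. Then the density $\Pi_{\mathbf{U}_n|\mathbf{V}_n}(\cdot\,|\,\mathbf{v})$ of the probability measure $\lambda_n^v\circ\mathcal{I}_n^{-1}$ on $\mathbb{R}^N$ satisfies $$\Pi_{\mathbf{U}_n|\mathbf{V}_n}(\mathbf{u}\,|\,\mathbf{v})\propto\exp\Big(-\frac12\int_{\mathbb{T}}\Big(-N\log(\epsilon^2+(Q_nv)^2)+(\epsilon^2+(Q_nv)^2)|D_qu|^2\Big)dx\Big).$$
   Context: $\mathbb{T}$ is the unit circle, identified with $[0,1]$ with $1$ identified with $0$. Fix $\epsilon>0$ and $q>1$. Let $D$ be the derivative, $Pf=\big(\int_{\mathbb{T}}f\,dt\big)\mathbf{1}$ with $\mathbf{1}(x)\equiv1$, and $D_q=D+\epsilon^qP:H^1(\mathbb{T})\to L^2(\mathbb{T})$, which is invertible. For $n\in\mathbb{N}$ let $N=2^n$, $K_j^N=[(j-1)/N,j/N)$, $j=1,\dots,N$, and $PL(n)=\{f\in C(\mathbb{T}):f\text{ is linear on each }K_j^N\}\subset H^1(\mathbb{T})$. Let $\{g_j\}_{j\ge1}$ be an orthonormal basis of $H^1(\mathbb{T})$ with respect to $\frac1{4\epsilon}\langle f,g\rangle_{L^2}+\epsilon\langle Df,Dg\rangle_{L^2}$ such that $\{g_j\}_{j=1}^N$ spans $PL(n)$ for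 each $n$, and $\{f_j\}_{j\ge1}$ an orthonormal basis of $H^1(\mathbb{T})$ with respect to $\langle D_qf,D_qg\rangle_{L^2}$ such that $\{f_j\}_{j=1}^N$ spans $PL(n)$ for each $n$. The maps $\mathcal{I}_n,\mathcal{J}_n:PL(n)\to\mathbb{R}^N$ are $\mathcal{I}_n\big(\sum_{j=1}^N\mathbf{x}_jf_j\big)=\mathbf{x}$ and $\mathcal{J}_n\big(\sum_{j=1}^N\mathbf{x}_jg_j\big)=\mathbf{x}$. For $v\in L^2(\mathbb{T})$ let $Q_nv=N\sum_{j=1}^N\big(\int_{K_j^N}v(x)\,dx\big)\mathbf{1}_{K_j^N}$, and let $\Lambda_n(v)$ be the multiplication operator $\Lambda_n(v)f=(\epsilon^2+(Q_nv)^2)^{-1}f$ on $L^2(\mathbb{T})$. For $v\in PL(n)$, $\lambda_n^v$ is the distribution of $\sum_{j=1}^N(\mathbf{C}^{1/2}\mathbf{W}_N)_jf_j$, where $\mathbf{C}\in\mathbb{R}^{N\times N}$ is the positive definite matrix $\mathbf{C}_{jk}=\langle\Lambda_n(v)D_qf_j,D_qf_k\rangle_{L^2}$ and $\mathbf{W}_N$ is a centered Gaussian vector in $\mathbb{R}^N$ with identity covariance; it is the conditional law of the discretized prior $U_n$ given $V_n=v$. The notation $\phi\propto\psi$ means $\phi\equiv c\,\psi$ with some constant $c$ (here independent of $\mathbf{u}$ and $\mathbf{v}$). *)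

theory Defs
  imports "HOL-Probability.Probability"
begin

text \<open>
  Functions on the circle are functions on the reals; elements of \<open>H1\<close> and \<open>PL n\<close> are
  1-periodic, so that each function on the circle has exactly one representative.
  Only the values on \<open>[0,1]\<close> matter for elements of \<open>L2\<close>, which are used up to null sets.
\<close>

definition L2 :: "(real \<Rightarrow> real) set" where
  "L2 = {f \<in> borel_measurable (lebesgue_on {0..1}). integrable (lebesgue_on {0..1}) (\<lambda>x. (f x)\<^sup>2)}"

abbreviation int_T :: "(real \<Rightarrow> real) \<Rightarrow> real" where
  "int_T f \<equiv> integral\<^sup>L (lebesgue_on {0..1}) f"

definition inner_L2 :: "(real \<Rightarrow> real) \<Rightarrow> (real \<Rightarrow> real) \<Rightarrow> real" where
  "inner_L2 f g = int_T (\<lambda>x. f x * g x)"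

text \<open>
  In one dimension \<open>H1\<close> consists of the absolutely continuous functions with square integrable
  derivative, i.e. those that are the indefinite integral of their derivative, which exists
  almost everywhere. Thus the (weak) derivative of \<open>f \<in> H1\<close> is \<open>deriv f\<close>; its unspecified
  values on the null set of non-differentiability are irrelevant.
\<close>

definition H1 :: "(real \<Rightarrow> real) set" where
  "H1 = {f. (\<forall>x. f (x + 1) = f x) \<and> deriv f \<in> L2 \<and>
            (\<forall>x\<in>{0..1}. f x = f 0 + (LINT t:{0..x}|lebesgue. deriv f t))}"

definition Dq :: "real \<Rightarrow> real \<Rightarrow> (real \<Rightarrow> real) \<Rightarrow> real \<Rightarrow> real" where
  "Dq \<epsilon> q f = (\<lambda>x. deriv f x + \<epsilon> powr q * int_T f)"

definition K :: "nat \<Rightarrow> nat \<Rightarrow> real set" where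
  "K N j = {(real j - 1) / real N ..< real j / real N}"

definition PL :: "nat \<Rightarrow> (real \<Rightarrow> real) set" where
  "PL n = {f. (\<forall>x. f (x + 1) = f x) \<and> continuous_on UNIV f \<and>
              (\<forall>j\<in>{1..2^n}. \<exists>a b. \<forall>x\<in>K (2^n) j. f x = a * x + b)}"

definition inner_g :: "real \<Rightarrow> (real \<Rightarrow> real) \<Rightarrow> (real \<Rightarrow> real) \<Rightarrow> real" where
  "inner_g \<epsilon> a b = 1 / (4 * \<epsilon>) * inner_L2 a b + \<epsilon> * inner_L2 (deriv a) (deriv b)"

definition inner_f :: "real \<Rightarrow> real \<Rightarrow> (real \<Rightarrow> real) \<Rightarrow> (real \<Rightarrow> real) \<Rightarrow> real" where
  "inner_f \<epsilon> q a b = inner_L2 (Dq \<epsilon> q a) (Dq \<epsilon> q b)"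

text \<open>Orthonormal basis, in the Hilbert space sense, with indices starting at 1; \<open>B\<close> is an
  inner product on \<open>H1\<close>.\<close>

definition orthonormal_basis_H1 ::
    "((real \<Rightarrow> real) \<Rightarrow> (real \<Rightarrow> real) \<Rightarrow> real) \<Rightarrow> (nat \<Rightarrow> real \<Rightarrow> real) \<Rightarrow> bool" where
  "orthonormal_basis_H1 B e \<longleftrightarrow>
     (\<forall>j\<ge>1. e j \<in> H1) \<and>
     (\<forall>j\<ge>1. \<forall>k\<ge>1. B (e j) (e k) = (if j = k then 1 else 0)) \<and>
     (\<forall>h\<in>H1. \<forall>\<delta>>0. \<exists>m c. let r = (\<lambda>x. h x - (\<Sum>j=1..m. c j * e j x)) in B r r < \<delta>)"

definition spans_PL :: "(nat \<Rightarrow> real \<Rightarrow> real) \<Rightarrow> nat \<Rightarrow> bool" where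
  "spans_PL e n \<longleftrightarrow> range (\<lambda>c x. \<Sum>j=1..2^n. (c j :: real) * e j x) = PL n"

text \<open>
  Vectors and matrices of size \<open>N = 2^n\<close> are indexed by a finite type \<open>'n\<close>, whose elements are
  enumerated as \<open>1, \<dots>, N\<close> by a bijection \<open>idx\<close>.
\<close>

definition lincomb :: "('n::finite \<Rightarrow> nat) \<Rightarrow> (nat \<Rightarrow> real \<Rightarrow> real) \<Rightarrow> real^'n \<Rightarrow> real \<Rightarrow> real" where
  "lincomb idx e \<xi> = (\<lambda>x. \<Sum>i\<in>UNIV. \<xi> $ i * e (idx i) x)"

definition coords :: "('n::finite \<Rightarrow> nat) \<Rightarrow> (nat \<Rightarrow> real \<Rightarrow> real) \<Rightarrow> (real \<Rightarrow> real) \<Rightarrow> real^'n" where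
  "coords idx e u = (THE \<xi>. lincomb idx e \<xi> = u)"

definition Qn :: "nat \<Rightarrow> (real \<Rightarrow> real) \<Rightarrow> real \<Rightarrow> real" where
  "Qn n v = (\<lambda>x. 2^n * (\<Sum>j=1..2^n. (LINT t:K (2^n) j|lebesgue. v t) * indicator (K (2^n) j) x))"

definition Lambda :: "real \<Rightarrow> nat \<Rightarrow> (real \<Rightarrow> real) \<Rightarrow> (real \<Rightarrow> real) \<Rightarrow> real \<Rightarrow> real" where
  "Lambda \<epsilon> n v h = (\<lambda>x. inverse (\<epsilon>\<^sup>2 + (Qn n v x)\<^sup>2) * h x)"

definition Cmat :: "real \<Rightarrow> real \<Rightarrow> ('n::finite \<Rightarrow> nat) \<Rightarrow> (nat \<Rightarrow> real \<Rightarrow> real) \<Rightarrow>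
    nat \<Rightarrow> (real \<Rightarrow> real) \<Rightarrow> real^'n^'n" where
  "Cmat \<epsilon> q idx f n v =
     (\<chi> j k. inner_L2 (Lambda \<epsilon> n v (Dq \<epsilon> q (f (idx j)))) (Dq \<epsilon> q (f (idx k))))"

definition psd_sqrt :: "real^'n^'n \<Rightarrow> real^'n^'n" where
  "psd_sqrt A = (THE S. transpose S = S \<and> (\<forall>x. 0 \<le> x \<bullet> (S *v x)) \<and> S ** S = A)"

text \<open>Non-degenerate Gaussian random vectors with mean \<open>m\<close> and covariance matrix \<open>A\<close>.\<close>

definition gaussian_vector ::
    "'w measure \<Rightarrow> ('w \<Rightarrow> real^'n) \<Rightarrow> real^'n \<Rightarrow> real^'n^'n \<Rightarrow> bool" where
  "gaussian_vector \<Omega> X m A \<longleftrightarrow>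
     prob_space \<Omega> \<and> transpose A = A \<and> (\<forall>x. x \<noteq> 0 \<longrightarrow> 0 < x \<bullet> (A *v x)) \<and>
     distributed \<Omega> lborel X
       (\<lambda>x. ennreal (exp (- ((x - m) \<bullet> (matrix_inv A *v (x - m))) / 2)
                     / sqrt ((2 * pi) ^ CARD('n) * det A)))"

definition dist_H1 :: "(real \<Rightarrow> real) \<Rightarrow> (real \<Rightarrow> real) \<Rightarrow> real" where
  "dist_H1 a b = (let d = (\<lambda>x. a x - b x) in sqrt (inner_L2 d d + inner_L2 (deriv d) (deriv d)))"

text \<open>The Borel sigma-algebra of \<open>PL n\<close> as a subspace of \<open>H1\<close>. Since \<open>PL n\<close> has finite
  dimension, any other norm yields the same one.\<close>

definition borel_PL :: "nat \<Rightarrow> (real \<Rightarrow> real) measure" where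
  "borel_PL n = sigma (PL n) {U. openin (Metric_space.mtopology (PL n) dist_H1) U}"

text \<open>The measure \<open>\<lambda>\<^sub>n\<^sup>v\<close>; \<open>W\<close> is the Gaussian vector on the probability space \<open>\<Omega>\<close>.\<close>

definition prior_cond :: "'w measure \<Rightarrow> ('w \<Rightarrow> real^'n) \<Rightarrow> real \<Rightarrow> real \<Rightarrow> ('n::finite \<Rightarrow> nat) \<Rightarrow>
    (nat \<Rightarrow> real \<Rightarrow> real) \<Rightarrow> nat \<Rightarrow> (real \<Rightarrow> real) \<Rightarrow> (real \<Rightarrow> real) measure" where
  "prior_cond \<Omega> W \<epsilon> q idx f n v =
     distr \<Omega> (borel_PL n) (\<lambda>\<omega>. lincomb idx f (psd_sqrt (Cmat \<epsilon> q idx f n v) *v W \<omega>))"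

end

theory Submission
  imports Defs
begin

text \<open>
  Write \<open>N = 2^n\<close>. For \<open>u \<in> PL n\<close> the function \<open>D\<^sub>q u\<close> is constant on each of the \<open>N\<close> cells of
  the dyadic partition, and so is \<open>Q\<^sub>n v\<close>. Integrals over the circle of functions of this kind are
  averages of \<open>N\<close> values. In particular, if \<open>R\<close> is the matrix of the coordinates of the functions
  \<open>D\<^sub>q f\<^sub>k\<close> with respect to the normalized cell indicators \<open>sqrt N 1\<^sub>K\<close>, then the orthonormality
  of the \<open>f\<^sub>k\<close> says that \<open>R\<close> is orthogonal (\<open>orthogonal_R\<close>). The multiplication operator
  \<open>\<Lambda>\<^sub>n(v)\<close> is diagonal with respect to the cell indicators, so \<open>C = R\<^sup>T diag(1/w) R\<close> with
  \<open>w\<^sub>i = \<epsilon>\<^sup>2 + (Q\<^sub>n v)\<^sup>2\<close> on the cell \<open>i\<close> (\<open>Cmat_eq\<close>). Therefore its square root is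
  \<open>R\<^sup>T diag(1 / sqrt w) R\<close>, and the image of a standard Gaussian vector under it has the density
  \<open>1 / sqrt ((2\<pi>)^N) sqrt (\<Prod>\<^sub>i w\<^sub>i) exp (- 1/2 \<Sum>\<^sub>i w\<^sub>i (R x)\<^sub>i\<^sup>2)\<close> (\<open>distributed_psd_sqrt_gaussian\<close>).
  Here \<open>\<Sum>\<^sub>i w\<^sub>i (R x)\<^sub>i\<^sup>2\<close> is the integral of \<open>(\<epsilon>\<^sup>2 + (Q\<^sub>n v)\<^sup>2) |D\<^sub>q u|\<^sup>2\<close> for the function \<open>u\<close> with
  coordinates \<open>x\<close>, and \<open>\<Sum>\<^sub>i log w\<^sub>i\<close> is \<open>N\<close> times the integral of \<open>log (\<epsilon>\<^sup>2 + (Q\<^sub>n v)\<^sup>2)\<close>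
  (\<open>int_T_exponent\<close>).

  Three further points need an argument. The square root is described by a definite description, so
  the uniqueness of positive semidefinite square roots is proved for the matrices at hand
  (\<open>psd_sqrt_conj_diag\<close>). The measure lives on \<open>PL n\<close> with the Borel sets of the \<open>H\<^sup>1\<close> metric; in
  coordinates this metric comes from a positive definite bilinear form, so it induces the Euclidean
  topology (\<open>openin_PL\<close>), and the coordinate maps are measurable both ways. Finally, \<open>v\<close> is determined
  by its coordinates with respect to \<open>g\<close>: these \<open>N\<close> functions span a space that is already known to
  have dimension \<open>N\<close>, so they are linearly independent (\<open>inj_lincomb\<close>).
\<close>

section \<open>Orthogonally diagonalized matrices and their square roots\<close>

text \<open>
  The diagonal matrix with diagonal entries \<open>d\<close>.
\<close>

definition diag_mat :: "('n \<Rightarrow> real) \<Rightarrow> real^'n^'n" where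
  "diag_mat d = (\<chi> i j. if i = j then d i else 0)"

lemma diag_mat_vector_mult: "diag_mat d *v x = (\<chi> i. d i * x $ i)"
  by (simp add: diag_mat_def matrix_vector_mult_def vec_eq_iff if_distrib[of "\<lambda>a. a * b" for b]
      cong: if_cong)

lemma diag_mat_mult: "diag_mat d ** diag_mat e = diag_mat (\<lambda>i. d i * e i)"
  by (simp add: matrix_eq matrix_vector_mul_assoc[symmetric] diag_mat_vector_mult vec_eq_iff
      mult.assoc)

lemma diag_mat_one: "diag_mat (\<lambda>i. 1) = mat 1"
  by (simp add: diag_mat_def mat_def)

lemma transpose_diag_mat: "transpose (diag_mat d) = diag_mat d"
  by (auto simp: diag_mat_def transpose_def vec_eq_iff)

lemma matrix_mul_diag_mat_right: "(A ** diag_mat d) $ i $ j = A $ i $ j * d j"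
proof -
  have "(A ** diag_mat d) $ i $ j = (\<Sum>k\<in>UNIV. if k = j then A $ i $ k * d k else 0)"
    unfolding matrix_matrix_mult_def diag_mat_def vec_lambda_beta by (intro sum.cong) auto
  then show ?thesis by simp
qed

lemma matrix_mul_diag_mat_left: "(diag_mat d ** A) $ i $ j = d i * A $ i $ j"
proof -
  have "(diag_mat d ** A) $ i $ j = (\<Sum>k\<in>UNIV. if i = k then d k * A $ k $ j else 0)"
    unfolding matrix_matrix_mult_def diag_mat_def vec_lambda_beta by (intro sum.cong) auto
  then show ?thesis by simp
qed

text \<open>
  The matrix \<open>R\<^sup>T diag(d) R\<close>. For orthogonal \<open>R\<close> it is the symmetric matrix with eigenvalues \<open>d i\<close>,
  whose eigenvectors are the rows of \<open>R\<close>.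
\<close>

definition conj_diag :: "real^'n^'n \<Rightarrow> ('n::finite \<Rightarrow> real) \<Rightarrow> real^'n^'n" where
  "conj_diag R d = transpose R ** diag_mat d ** R"

lemma orthogonal_matrix_cancel:
  fixes R :: "real^'n^'n"
  assumes "orthogonal_matrix R"
  shows "transpose R ** R = mat 1" "R ** transpose R = mat 1"
    "A ** R ** transpose R = A" "A ** transpose R ** R = A"
    "R ** (transpose R ** B) = B" "transpose R ** (R ** B) = B"
  using assms
  by (simp_all add: orthogonal_matrix_def matrix_mul_assoc[symmetric],
      simp_all add: orthogonal_matrix_def matrix_mul_assoc)

lemma transpose_conj_diag: "transpose (conj_diag R d) = conj_diag R d"
  by (simp add: conj_diag_def matrix_transpose_mul transpose_diag_mat transpose_transpose
      matrix_mul_assoc)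

lemma conj_diag_mult:
  assumes "orthogonal_matrix R"
  shows "conj_diag R d ** conj_diag R e = conj_diag R (\<lambda>i. d i * e i)"
  by (simp add: conj_diag_def matrix_mul_assoc orthogonal_matrix_cancel[OF assms]
      diag_mat_mult[symmetric])

lemma conj_diag_one: "orthogonal_matrix R \<Longrightarrow> conj_diag R (\<lambda>i. 1) = mat 1"
  by (simp add: conj_diag_def diag_mat_one orthogonal_matrix_cancel)

lemma inner_conj_diag:
  fixes R :: "real^'n^'n"
  shows "x \<bullet> (conj_diag R d *v y) = (\<Sum>i\<in>UNIV. d i * ((R *v x) $ i * (R *v y) $ i))"
proof -
  have "x \<bullet> (conj_diag R d *v y) = x \<bullet> (transpose R *v (diag_mat d *v (R *v y)))"
    by (simp add: conj_diag_def matrix_vector_mul_assoc matrix_mul_assoc)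
  also have "\<dots> = (R *v x) \<bullet> (diag_mat d *v (R *v y))"
    by (metis dot_lmul_matrix transpose_transpose matrix_vector_mul_assoc inner_commute transpose_matrix_vector)
  finally show ?thesis
    by (simp add: inner_vec_def diag_mat_vector_mult mult_ac)
qed

lemma norm_conj_diag:
  fixes R :: "real^'n^'n"
  assumes "orthogonal_matrix R"
  shows "(conj_diag R d *v x) \<bullet> (conj_diag R d *v x) = (\<Sum>i\<in>UNIV. (d i)\<^sup>2 * ((R *v x) $ i)\<^sup>2)"
proof -
  have "(conj_diag R d *v x) \<bullet> (conj_diag R d *v x) = x \<bullet> ((conj_diag R d ** conj_diag R d) *v x)"
    by (metis dot_lmul_matrix transpose_conj_diag transpose_matrix_vector matrix_vector_mul_assoc)
  then show ?thesis
    by (simp add: conj_diag_mult[OF assms] inner_conj_diag power2_eq_square)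
qed

lemma conj_diag_pos_def:
  fixes R :: "real^'n^'n"
  assumes R: "orthogonal_matrix R" and d: "\<And>i. d i > 0" and "x \<noteq> 0"
  shows "0 < x \<bullet> (conj_diag R d *v x)"
proof -
  have "R *v x \<noteq> 0"
    by (metis R \<open>x \<noteq> 0\<close> matrix_vector_mul_assoc matrix_vector_mul_lid matrix_vector_mult_0_right
        orthogonal_matrix_cancel(1))
  then obtain k where k: "(R *v x) $ k \<noteq> 0"
    by (auto simp: vec_eq_iff)
  have "0 < (\<Sum>i\<in>UNIV. d i * ((R *v x) $ i * (R *v x) $ i))"
    by (rule sum_pos2[of _ k]) (use d k in \<open>auto simp: less_imp_le intro!: mult_pos_pos
          mult_nonneg_nonneg simp: zero_less_mult_iff\<close>)
  then show ?thesis
    by (simp add: inner_conj_diag)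
qed

text \<open>
  Since \<open>S\<close> and \<open>T\<close> commute, \<open>(S + T) (S - T) = S\<^sup>2 - T\<^sup>2 = 0\<close>, and \<open>S + T\<close> is positive definite.
\<close>

lemma commuting_square_roots_eq:
  fixes S T :: "real^'n^'n"
  assumes S: "\<And>x. 0 \<le> x \<bullet> (S *v x)" and T: "\<And>x. x \<noteq> 0 \<Longrightarrow> 0 < x \<bullet> (T *v x)"
    and sq: "S ** S = T ** T" and comm: "S ** T = T ** S"
  shows "S = T"
proof (subst matrix_eq, intro allI)
  fix x
  define y where "y = S *v x - T *v x"
  have "S *v y + T *v y = (S ** S) *v x - (S ** T) *v x + (T ** S) *v x - (T ** T) *v x"
    by (simp add: y_def matrix_vector_mult_diff_distrib matrix_vector_mul_assoc)
  then have "y \<bullet> (S *v y) + y \<bullet> (T *v y) = 0"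
    by (simp add: sq comm flip: inner_add_right)
  with S[of y] T[of y] have "y = 0"
    by (cases "y = 0") auto
  then show "S *v x = T *v x"
    by (simp add: y_def)
qed

lemma psd_sqrt_conj_diag:
  fixes R :: "real^'n^'n"
  assumes R: "orthogonal_matrix R" and d: "\<And>i. d i > 0"
  shows "psd_sqrt (conj_diag R d) = conj_diag R (\<lambda>i. sqrt (d i))"
  unfolding psd_sqrt_def
proof (rule the_equality)
  let ?T = "conj_diag R (\<lambda>i. sqrt (d i))"
  have T: "0 < x \<bullet> (?T *v x)" if "x \<noteq> 0" for x
    using conj_diag_pos_def[OF R _ that] d by simp
  have TT: "?T ** ?T = conj_diag R d"
    using d by (simp add: conj_diag_mult[OF R] less_imp_le)
  show "transpose ?T = ?T \<and> (\<forall>x. 0 \<le> x \<bullet> (?T *v x)) \<and> ?T ** ?T = conj_diag R d"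
    using T TT by (metis transpose_conj_diag inner_zero_left less_imp_le order_refl)
  fix S assume S: "transpose S = S \<and> (\<forall>x. 0 \<le> x \<bullet> (S *v x)) \<and> S ** S = conj_diag R d"
  define S' where "S' = R ** S ** transpose R"
  have S_eq: "S = transpose R ** S' ** R"
    by (simp add: S'_def matrix_mul_assoc orthogonal_matrix_cancel[OF R])
  have D: "diag_mat d = R ** conj_diag R d ** transpose R"
    by (simp add: conj_diag_def matrix_mul_assoc orthogonal_matrix_cancel[OF R])
  \<comment> \<open>\<open>S\<close> commutes with its square, so in the eigenbasis its entries vanish between
     different eigenvalues; hence it commutes with \<open>?T\<close> as well.\<close>
  have "S ** conj_diag R d = conj_diag R d ** S"
    using S by (metis matrix_mul_assoc)
  then have "R ** (S ** conj_diag R d) ** transpose R = R ** (conj_diag R d ** S) ** transpose R"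
    by simp
  then have "S' ** diag_mat d = diag_mat d ** S'"
    by (simp add: S'_def D matrix_mul_assoc orthogonal_matrix_cancel[OF R])
  then have "S' $ i $ j * d j = d i * S' $ i $ j" for i j
    by (metis matrix_mul_diag_mat_left matrix_mul_diag_mat_right)
  then have "S' $ i $ j = 0 \<or> d i = d j" for i j
    by (metis mult.commute mult_cancel_left)
  then have "S' $ i $ j * sqrt (d j) = sqrt (d i) * S' $ i $ j" for i j
    by (metis mult.commute mult_zero_left)
  then have *: "S' ** diag_mat (\<lambda>i. sqrt (d i)) = diag_mat (\<lambda>i. sqrt (d i)) ** S'"
    by (simp add: vec_eq_iff matrix_mul_diag_mat_left matrix_mul_diag_mat_right)
  have "S ** ?T = transpose R ** (S' ** diag_mat (\<lambda>i. sqrt (d i))) ** R"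
    by (simp add: S_eq conj_diag_def matrix_mul_assoc orthogonal_matrix_cancel[OF R])
  also have "\<dots> = ?T ** S"
    by (simp add: * S_eq conj_diag_def matrix_mul_assoc orthogonal_matrix_cancel[OF R])
  finally have comm: "S ** ?T = ?T ** S" .
  have psd: "0 \<le> x \<bullet> (S *v x)" for x
    using S by blast
  have sq: "S ** S = ?T ** ?T"
    unfolding TT using S by blast
  show "S = ?T"
    by (rule commuting_square_roots_eq[OF psd T sq comm])
qed

section \<open>Lebesgue measure under orthogonally diagonalized maps\<close>

text \<open>
  One half of the invariance of Lebesgue measure under orthogonal maps. Such a map sends balls to balls
  of the same radius, and by the Vitali covering theorem an open set is a countable disjoint union of
  balls up to a null set. An inequality comes out because nothing is used about the image of the null
  set; applied to the inverse map it yields the reverse inequality.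
\<close>

lemma emeasure_orthogonal_image_ge:
  fixes T :: "'a::euclidean_space \<Rightarrow> 'a"
  assumes T: "orthogonal_transformation T" and U: "open U"
  shows "emeasure lborel U \<le> emeasure lborel (T ` U)"
proof -
  have "\<exists>i. i \<in> {(y, s). 0 < s \<and> ball y s \<subseteq> U} \<and> x \<in> ball (fst i) (snd i) \<and> snd i < d"
    if x: "x \<in> U" and "0 < d" for x d
  proof -
    obtain e where "0 < e" "ball x e \<subseteq> U"
      using U x by (auto simp: open_contains_ball)
    then show ?thesis
      using \<open>0 < d\<close> by (intro exI[of _ "(x, min e (d / 2))"]) auto
  qed
  then obtain C where C: "countable C" "C \<subseteq> {(y, s). 0 < s \<and> ball y s \<subseteq> U}"
      "pairwise (\<lambda>i j. disjnt (ball (fst i) (snd i)) (ball (fst j) (snd j))) C"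
      "negligible (U - (\<Union>i\<in>C. ball (fst i) (snd i)))"
    by (rule Vitali_covering_theorem_balls)
  let ?B = "\<lambda>i. ball (fst i) (snd i)"
  have disj: "disjoint_family_on ?B C"
    using C(3) by (auto simp: disjoint_family_on_def pairwise_def disjnt_def)
  have TB: "T ` ?B i = ball (T (fst i)) (snd i)" for i
    by (rule image_orthogonal_transformation_ball[OF T])
  have disjT: "disjoint_family_on (\<lambda>i. T ` ?B i) C"
    using disj orthogonal_transformation_inj[OF T]
    by (auto simp: disjoint_family_on_def image_Int[symmetric])
  have "emeasure lborel U \<le> emeasure lborel ((\<Union>i\<in>C. ?B i) \<union> (U - (\<Union>i\<in>C. ?B i)))"
    using U by (intro emeasure_mono) (auto intro!: borel_open)
  also have "\<dots> = emeasure lborel (\<Union>i\<in>C. ?B i)"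
  proof (rule emeasure_Un_null_set)
    have "U - (\<Union>i\<in>C. ?B i) \<in> sets lborel"
      using U by (intro sets.Diff) (auto intro!: borel_open)
    then show "U - (\<Union>i\<in>C. ?B i) \<in> null_sets lborel"
      using C(4) by (simp add: negligible_iff_null_sets null_sets_completion_iff)
  qed (auto intro!: borel_open)
  also have "\<dots> = (\<integral>\<^sup>+i. emeasure lborel (?B i) \<partial>count_space C)"
    using C(1) disj by (intro emeasure_UN_countable) auto
  also have "\<dots> = (\<integral>\<^sup>+i. emeasure lborel (T ` ?B i) \<partial>count_space C)"
    using C(2) by (intro nn_integral_cong) (auto simp: TB emeasure_ball)
  also have "\<dots> = emeasure lborel (\<Union>i\<in>C. T ` ?B i)"
    using C(1) disjT by (intro emeasure_UN_countable[symmetric]) (auto simp: TB)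
  also have "\<dots> \<le> emeasure lborel (T ` U)"
  proof (rule emeasure_mono)
    show "(\<Union>i\<in>C. T ` ?B i) \<subseteq> T ` U"
    proof (intro UN_least image_mono)
      show "?B i \<subseteq> U" if "i \<in> C" for i
        using C(2) that by (cases i) auto
    qed
    have "open (T ` U)"
      using T U by (simp add: open_bijective_linear_image_eq orthogonal_transformation_bij
          orthogonal_transformation_linear)
    then show "T ` U \<in> sets lborel"
      by simp
  qed
  finally show ?thesis .
qed

lemma distr_lborel_orthogonal:
  fixes T :: "'a::euclidean_space \<Rightarrow> 'a"
  assumes T: "orthogonal_transformation T"
  shows "distr lborel borel T = lborel"
proof (rule lborel_eqI[symmetric])
  note [simp] = orthogonal_transformation_inj[OF T] orthogonal_transformation_surj[OF T]
  have [measurable]: "T \<in> borel_measurable borel"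
    using T by (intro borel_measurable_continuous_onI linear_continuous_on)
      (simp add: orthogonal_transformation_linear linear_conv_bounded_linear[symmetric])
  fix l u :: 'a
  assume lu: "\<And>b. b \<in> Basis \<Longrightarrow> l \<bullet> b \<le> u \<bullet> b"
  have vim: "T -` box l u = inv T ` box l u"
    by (simp add: bij_vimage_eq_inv_image orthogonal_transformation_bij[OF T])
  have "open (T -` box l u)"
    using T by (intro open_vimage open_box linear_continuous_on)
      (simp add: orthogonal_transformation_linear linear_conv_bounded_linear[symmetric])
  from emeasure_orthogonal_image_ge[OF T this]
  have "emeasure lborel (T -` box l u) \<le> emeasure lborel (box l u)"
    by (simp add: surj_image_vimage_eq)
  moreover have "emeasure lborel (box l u) \<le> emeasure lborel (T -` box l u)"
    unfolding vim by (intro emeasure_orthogonal_image_ge orthogonal_transformation_inv T open_box)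
  ultimately show "emeasure (distr lborel borel T) (box l u) = ennreal (\<Prod>b\<in>Basis. (u - l) \<bullet> b)"
    using lu by (simp add: emeasure_distr antisym)
qed simp

lemma measurable_matrix_vector_mult [measurable]:
  "(*v) (A :: real^'n^'m) \<in> borel_measurable borel"
  by (simp add: linear_continuous_on borel_measurable_continuous_onI matrix_vector_mul_bounded_linear)

lemma lborel_eq_density_diag_mat:
  fixes d :: "'n::finite \<Rightarrow> real"
  assumes d: "\<And>i. d i \<noteq> 0"
  shows "lborel = density (distr lborel borel ((*v) (diag_mat d))) (\<lambda>_. ennreal (\<Prod>i\<in>UNIV. \<bar>d i\<bar>))"
proof -
  have Basis: "(Basis :: (real^'n) set) = range (\<lambda>i. axis i 1)"
    by (auto simp: Basis_vec_def)
  have inj: "inj (\<lambda>i::'n. axis i (1::real))"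
    by (auto simp: inj_on_def axis_eq_axis)
  let ?c = "\<lambda>b. (\<chi> i. d i) \<bullet> b"
  have "0 + (\<Sum>j\<in>Basis. (?c j * (x \<bullet> j)) *\<^sub>R j) = diag_mat d *v x" for x :: "real^'n"
    by (rule euclidean_eqI)
      (auto simp: inner_sum_left inner_Basis if_distrib Basis_vec_def inner_axis diag_mat_vector_mult cong: if_cong)
  moreover have "(\<Prod>j\<in>Basis. \<bar>?c j\<bar>) = (\<Prod>i\<in>UNIV. \<bar>d i\<bar>)"
    unfolding Basis by (subst prod.reindex[OF inj]) (simp add: inner_axis)
  moreover have "?c j \<noteq> 0" if "j \<in> Basis" for j
    using that d by (auto simp: Basis inner_axis)
  ultimately show ?thesis
    using lborel_affine_euclidean[of ?c 0] by simp
qed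

lemma distr_lborel_conj_diag:
  fixes R :: "real^'n^'n"
  assumes R: "orthogonal_matrix R" and ab: "\<And>i. a i * b i = 1"
  shows "distr lborel borel ((*v) (conj_diag R a)) = density lborel (\<lambda>_. ennreal (\<Prod>i\<in>UNIV. \<bar>b i\<bar>))"
proof -
  have a: "a i \<noteq> 0" for i
    using ab[of i] by auto
  have orth: "orthogonal_transformation ((*v) R)" "orthogonal_transformation ((*v) (transpose R))"
    using R by (auto simp: orthogonal_transformation_matrix orthogonal_matrix_transpose)
  have prod1: "(\<Prod>i\<in>UNIV. \<bar>a i\<bar>) * (\<Prod>i\<in>UNIV. \<bar>b i\<bar>) = 1"
    by (simp add: prod.distrib[symmetric] abs_mult[symmetric] ab)
  let ?D = "distr lborel borel ((*v) (diag_mat a))"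
  have "density lborel (\<lambda>_. ennreal (\<Prod>i\<in>UNIV. \<bar>b i\<bar>)) =
    density (density ?D (\<lambda>_. ennreal (\<Prod>i\<in>UNIV. \<bar>a i\<bar>))) (\<lambda>_. ennreal (\<Prod>i\<in>UNIV. \<bar>b i\<bar>))"
    using lborel_eq_density_diag_mat[of a] a by simp
  also have "\<dots> = ?D"
    by (simp add: density_density_eq ennreal_mult'[symmetric] prod_nonneg prod1 density_1)
  finally have D: "?D = density lborel (\<lambda>_. ennreal (\<Prod>i\<in>UNIV. \<bar>b i\<bar>))" ..
  have "distr lborel borel ((*v) (conj_diag R a)) =
      distr (distr (distr lborel borel ((*v) R)) borel ((*v) (diag_mat a))) borel ((*v) (transpose R))"
    by (simp add: distr_distr comp_def conj_diag_def matrix_vector_mul_assoc matrix_mul_assoc)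
  also have "\<dots> = distr (density lborel (\<lambda>_. ennreal (\<Prod>i\<in>UNIV. \<bar>b i\<bar>))) borel ((*v) (transpose R))"
    by (simp add: distr_lborel_orthogonal orth D)
  also have "\<dots> = density lborel (\<lambda>_. ennreal (\<Prod>i\<in>UNIV. \<bar>b i\<bar>))"
    by (subst density_distr[symmetric]) (simp_all add: distr_lborel_orthogonal orth)
  finally show ?thesis .
qed

section \<open>Images of Gaussian vectors\<close>

lemma distributed_conj_diag:
  fixes R :: "real^'n^'n"
  assumes R: "orthogonal_matrix R" and ab: "\<And>i. a i * b i = 1" and W: "distributed M lborel W f"
  shows "distributed M lborel (\<lambda>\<omega>. conj_diag R a *v W \<omega>)
    (\<lambda>x. ennreal (\<Prod>i\<in>UNIV. \<bar>b i\<bar>) * f (conj_diag R b *v x))"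
proof -
  let ?A = "conj_diag R a" and ?B = "conj_diag R b"
  have [measurable]: "W \<in> borel_measurable M" "f \<in> borel_measurable borel"
    using W by (auto simp: distributed_def)
  have BA: "?B ** ?A = mat 1"
    using ab by (simp add: conj_diag_mult[OF R] mult.commute conj_diag_one[OF R])
  have "distr M lborel (\<lambda>\<omega>. ?A *v W \<omega>) = distr (distr M lborel W) lborel ((*v) ?A)"
    by (simp add: distr_distr comp_def)
  also have "\<dots> = distr (density lborel f) borel ((*v) ?A)"
    using W by (simp add: distributed_def cong: distr_cong)
  also have "\<dots> = distr (density lborel (\<lambda>x. f (?B *v (?A *v x)))) borel ((*v) ?A)"
    by (simp add: matrix_vector_mul_assoc BA)
  also have "\<dots> = density (distr lborel borel ((*v) ?A)) (\<lambda>x. f (?B *v x))"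
    by (subst density_distr) simp_all
  also have "\<dots> = density lborel (\<lambda>x. ennreal (\<Prod>i\<in>UNIV. \<bar>b i\<bar>) * f (?B *v x))"
    by (subst distr_lborel_conj_diag[OF R ab], subst density_density_eq) simp_all
  finally show ?thesis
    by (simp add: distributed_def)
qed

text \<open>
  The density of \<open>C^(1/2) W\<close> for a standard Gaussian vector \<open>W\<close>, where \<open>C\<close> has the eigenvalues \<open>1 / w i\<close>.
  The determinant factor \<open>\<Prod>\<^sub>i sqrt (w i)\<close> is moved into the exponent.
\<close>

lemma distributed_psd_sqrt_gaussian:
  fixes R :: "real^'n^'n"
  assumes W: "gaussian_vector M W 0 (mat 1)" and R: "orthogonal_matrix R" and w: "\<And>i. w i > 0"
  shows "distributed M lborel (\<lambda>\<omega>. psd_sqrt (conj_diag R (\<lambda>i. inverse (w i))) *v W \<omega>)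
    (\<lambda>x. ennreal (1 / sqrt ((2 * pi) ^ CARD('n)) *
        exp (- (1/2) * (\<Sum>i\<in>UNIV. - ln (w i) + w i * ((R *v x) $ i)\<^sup>2))))"
proof -
  let ?A = "conj_diag R (\<lambda>i. sqrt (inverse (w i)))" and ?B = "conj_diag R (\<lambda>i. sqrt (w i))"
  have sq: "psd_sqrt (conj_diag R (\<lambda>i. inverse (w i))) = ?A"
    using w by (intro psd_sqrt_conj_diag R) simp
  have ab: "sqrt (inverse (w i)) * sqrt (w i) = 1" for i
    using w[of i] by (simp add: real_sqrt_inverse)
  have inv1: "matrix_inv (mat 1 :: real^'n^'n) = mat 1"
    unfolding matrix_inv_def by (rule some_equality) auto
  have "distributed M lborel W
     (\<lambda>x. ennreal (exp (- (x \<bullet> x) / 2) / sqrt ((2 * pi) ^ CARD('n))))"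
    using W by (simp add: gaussian_vector_def inv1 det_I)
  from distributed_conj_diag[OF R ab this]
  have *: "distributed M lborel (\<lambda>\<omega>. ?A *v W \<omega>)
     (\<lambda>x. ennreal (\<Prod>i\<in>UNIV. \<bar>sqrt (w i)\<bar>) *
        ennreal (exp (- ((?B *v x) \<bullet> (?B *v x)) / 2) / sqrt ((2 * pi) ^ CARD('n))))" .
  have "(\<Prod>i\<in>UNIV. \<bar>sqrt (w i)\<bar>) = (\<Prod>i\<in>UNIV. exp (ln (w i) / 2))"
    using w by (intro prod.cong refl) (simp add: ln_sqrt[symmetric] less_imp_le)
  then have det: "(\<Prod>i\<in>UNIV. \<bar>sqrt (w i)\<bar>) = exp (\<Sum>i\<in>UNIV. ln (w i) / 2)"
    by (simp add: exp_sum)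
  have norm: "(?B *v x) \<bullet> (?B *v x) = (\<Sum>i\<in>UNIV. w i * ((R *v x) $ i)\<^sup>2)" for x
    using w by (simp add: norm_conj_diag[OF R] less_imp_le)
  have "(\<Prod>i\<in>UNIV. \<bar>sqrt (w i)\<bar>) * (exp (- ((?B *v x) \<bullet> (?B *v x)) / 2) / sqrt ((2 * pi) ^ CARD('n))) =
     1 / sqrt ((2 * pi) ^ CARD('n)) *
        exp (- (1/2) * (\<Sum>i\<in>UNIV. - ln (w i) + w i * ((R *v x) $ i)\<^sup>2))" for x
  proof -
    have "- (1/2) * (\<Sum>i\<in>UNIV. - ln (w i) + w i * ((R *v x) $ i)\<^sup>2) =
        (\<Sum>i\<in>UNIV. ln (w i) / 2) + - (\<Sum>i\<in>UNIV. w i * ((R *v x) $ i)\<^sup>2) / 2"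
      by (simp only: sum.distrib sum_negf sum_divide_distrib[symmetric]) (simp add: field_simps)
    then show ?thesis
      unfolding det norm by (simp only: exp_add) simp
  qed
  then show ?thesis
    using * by (simp add: sq ennreal_mult'[symmetric] prod_nonneg)
qed

section \<open>Functions that are constant on the dyadic cells\<close>

text \<open>
  The interior of the \<open>j\<close>-th dyadic interval of length \<open>2^-n\<close>. The end points are left out because
  piecewise linear functions need not be differentiable there.
\<close>

definition cell :: "nat \<Rightarrow> nat \<Rightarrow> real set" where
  "cell n j = {(real j - 1) / 2^n <..< real j / 2^n}"

text \<open>
  The midpoint of a cell, the representative at which cellwise constant functions are evaluated.
\<close>

definition mid :: "nat \<Rightarrow> nat \<Rightarrow> real" where
  "mid n j = (real j - 1/2) / 2^n"

text \<open>
  Functions that are constant on every cell in \<open>[0,1]\<close>; their values elsewhere are arbitrary.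
\<close>

definition cellwise_const :: "nat \<Rightarrow> (real \<Rightarrow> real) \<Rightarrow> bool" where
  "cellwise_const n h \<longleftrightarrow> (\<forall>j\<in>{1..2^n}. \<forall>x\<in>cell n j. h x = h (mid n j))"

lemma mid_in_cell: "mid n j \<in> cell n j"
  by (auto simp: mid_def cell_def divide_strict_right_mono)

lemma mem_cell_iff: "x \<in> cell n j \<longleftrightarrow> real j - 1 < x * 2^n \<and> x * 2^n < real j"
  by (auto simp: cell_def field_simps)

lemma cell_unique: "x \<in> cell n j \<Longrightarrow> x \<in> cell n k \<Longrightarrow> j = k"
  unfolding mem_cell_iff by linarith

lemma cell_subset: "j \<in> {1..2^n} \<Longrightarrow> cell n j \<subseteq> {0..1}"
proof
  fix x assume j: "j \<in> {1..2^n}" and x: "x \<in> cell n j"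
  have "real j \<le> 2^n" "1 \<le> real j"
    using j by simp_all
  then have "0 < x * 2^n" "x * 2^n < 1 * 2^n"
    using x unfolding mem_cell_iff by linarith+
  then have "0 < x" "x < 1"
    by (simp_all add: zero_less_mult_iff)
  then show "x \<in> {0..1}"
    by simp
qed

lemma cell_cover:
  assumes "x \<in> {0..1}" and "x \<notin> (\<lambda>k. real k / 2^n) ` UNIV"
  shows "\<exists>j\<in>{1..2^n}. x \<in> cell n j"
proof
  define k where "k = nat \<lfloor>x * 2^n\<rfloor>"
  have k: "real k \<le> x * 2^n" "x * 2^n < real k + 1"
    using assms(1) by (auto simp: k_def)
  moreover have "x * 2^n \<noteq> real k"
    using assms(2) by (auto simp: image_iff field_simps)
  ultimately show "x \<in> cell n (Suc k)"
    by (auto simp: mem_cell_iff)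
  have "x * 2^n \<le> 2^n" using assms(1) by simp
  with k \<open>x * 2^n \<noteq> real k\<close> have "real k < 2^n" by linarith
  then have "k < 2^n" by simp
  then show "Suc k \<in> {1..2^n}" by simp
qed

text \<open>
  The integral is the average of the values on the cells. Measurability is not needed as a hypothesis,
  since the function agrees with a step function off a countable set.
\<close>

lemma int_T_cellwise_const:
  assumes "cellwise_const n h"
  shows "int_T h = (\<Sum>j=1..2^n. h (mid n j)) / 2^n"
proof -
  define s where "s = (\<lambda>x. \<Sum>j::nat=1..2^n. h (mid n j) * indicator (cell n j) x)"
  have "int_T h = int_T s"
  proof (rule integral_discrete_difference[where X = "{0..1} \<inter> (\<lambda>k. real k / 2^n) ` UNIV"])
    fix x :: real
    assume "x \<in> space (lebesgue_on {0..1})" and "x \<notin> {0..1} \<inter> (\<lambda>k. real k / 2^n) ` UNIV"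
    then obtain j where j: "j \<in> {1..2^n}" "x \<in> cell n j"
      using cell_cover[of x n] by (auto simp: space_restrict_space)
    have "s x = (\<Sum>i=1..2^n. if i = j then h (mid n j) else 0)"
      unfolding s_def using j cell_unique by (intro sum.cong) (auto simp: indicator_def)
    then show "h x = s x"
      using j assms by (simp add: cellwise_const_def)
  qed (auto simp: emeasure_restrict_space sets_restrict_space)
  also have "\<dots> = (\<Sum>j=1..2^n. h (mid n j) * measure lebesgue (cell n j))"
    unfolding s_def
  proof (subst Bochner_Integration.integral_sum)
    fix j :: nat assume j: "j \<in> {1..2^n}"
    have "cell n j \<in> sets (lebesgue_on {0..1})"
      using cell_subset[OF j] by (simp add: cell_def sets_restrict_space_iff)
    then show "integrable (lebesgue_on {0..1}) (\<lambda>x. h (mid n j) * indicator (cell n j) x)"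
      using cell_subset[OF j]
      by (auto intro!: integrable_real_indicator
          simp: emeasure_restrict_space cell_def divide_right_mono)
  next
    show "(\<Sum>j=1..2^n. int_T (\<lambda>x. h (mid n j) * indicator (cell n j) x)) =
      (\<Sum>j=1..2^n. h (mid n j) * measure lebesgue (cell n j))"
    proof (intro sum.cong refl)
      fix j :: nat assume j: "j \<in> {1..2^n}"
      have "cell n j \<inter> {0..1} = cell n j" using cell_subset[OF j] by auto
      then show "int_T (\<lambda>x. h (mid n j) * indicator (cell n j) x) = h (mid n j) * measure lebesgue (cell n j)"
        using cell_subset[OF j]
        by (simp add: measure_restrict_space space_restrict_space cell_def)
    qed
  qed
  also have "\<dots> = (\<Sum>j=1..2^n. h (mid n j)) / 2^n"
    by (simp add: cell_def sum_divide_distrib diff_divide_distrib divide_right_mono)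
  finally show ?thesis .
qed

lemma int_T_cellwise_const_idx:
  assumes "bij_betw idx UNIV {1..2^n}" and "cellwise_const n h"
  shows "int_T h = (\<Sum>i\<in>UNIV. h (mid n (idx i))) / 2^n"
  using sum.reindex_bij_betw[OF assms(1), of "\<lambda>j. h (mid n j)"] int_T_cellwise_const[OF assms(2)]
  by simp

lemma cellwise_const_compose1:
  "cellwise_const n a \<Longrightarrow> cellwise_const n (\<lambda>x. \<phi> (a x))"
  unfolding cellwise_const_def by metis

lemma cellwise_const_compose2:
  "cellwise_const n a \<Longrightarrow> cellwise_const n b \<Longrightarrow> cellwise_const n (\<lambda>x. \<phi> (a x) (b x))"
  unfolding cellwise_const_def by metis

lemma cellwise_const_Qn: "cellwise_const n (Qn n v)"
  unfolding cellwise_const_def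
proof (intro ballI)
  fix j x assume j: "j \<in> {1..2^n}" and x: "x \<in> cell n j"
  \<comment> \<open>All points of a cell lie in the same half-open interval.\<close>
  have "y \<in> K (2^n) k \<longleftrightarrow> k = j" if "y \<in> cell n j" for y k
    using that unfolding mem_cell_iff by (auto simp: K_def field_simps)
  then have "indicator (K (2^n) k) x = (indicator (K (2^n) k) (mid n j) :: real)" for k
    using x mid_in_cell[of n j] by (simp add: indicator_def)
  then show "Qn n v x = Qn n v (mid n j)"
    unfolding Qn_def by (simp only:)
qed

lemma PL_has_derivative_mid:
  assumes "u \<in> PL n" and "j \<in> {1..2^n}" and "x \<in> cell n j"
  shows "(u has_field_derivative deriv u (mid n j)) (at x)"
proof -
  obtain a b where ab: "\<And>y. y \<in> K (2^n) j \<Longrightarrow> u y = a * y + b"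
    using assms by (fastforce simp: PL_def)
  have D: "(u has_field_derivative a) (at y)" if "y \<in> cell n j" for y
  proof (rule has_field_derivative_transform_within_open[of "\<lambda>y. a * y + b" _ _ "cell n j"])
    show "((\<lambda>y. a * y + b) has_field_derivative a) (at y)"
      by (auto intro!: derivative_eq_intros)
    show "a * z + b = u z" if "z \<in> cell n j" for z
      using that ab[of z] by (auto simp: cell_def K_def)
  qed (use that in \<open>auto simp: cell_def\<close>)
  with assms(3) mid_in_cell show ?thesis
    by (metis DERIV_imp_deriv)
qed

lemma cellwise_const_deriv_PL: "u \<in> PL n \<Longrightarrow> cellwise_const n (deriv u)"
  by (auto simp: cellwise_const_def intro!: DERIV_imp_deriv PL_has_derivative_mid)

lemma cellwise_const_Dq: "u \<in> PL n \<Longrightarrow> cellwise_const n (Dq \<epsilon> q u)"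
  unfolding Dq_def
  by (intro cellwise_const_compose1[where \<phi> = "\<lambda>t. t + c" for c] cellwise_const_deriv_PL)

lemma integrable_PL:
  assumes "u \<in> PL n" shows "integrable (lebesgue_on {0..1}) u"
  using assms by (auto simp: PL_def intro!: continuous_imp_integrable_real elim: continuous_on_subset)

lemma integrable_PL_mult:
  assumes "u \<in> PL n" "v \<in> PL n" shows "integrable (lebesgue_on {0..1}) (\<lambda>x. u x * v x)"
  using assms by (auto simp: PL_def intro!: continuous_imp_integrable_real continuous_on_mult
      elim: continuous_on_subset)

section \<open>Bases of the space of piecewise linear functions\<close>

lemma lincomb_diff: "lincomb idx e (x - y) = (\<lambda>t. lincomb idx e x t - lincomb idx e y t)"
  by (simp add: lincomb_def fun_eq_iff algebra_simps sum_subtractf)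

lemma range_lincomb:
  assumes "bij_betw idx UNIV {1..2^n}" and "spans_PL e n"
  shows "range (lincomb idx e) = PL n"
proof -
  have *: "(\<lambda>x. \<Sum>j=1..2^n. c j * e j x) = lincomb idx e (\<chi> i. c (idx i))" for c
    using sum.reindex_bij_betw[OF assms(1), of "\<lambda>j. c j * e j x" for x]
    by (simp add: lincomb_def)
  have **: "lincomb idx e \<xi> = (\<lambda>x. \<Sum>j=1..2^n. \<xi> $ (inv_into UNIV idx j) * e j x)" for \<xi>
    using sum.reindex_bij_betw[OF assms(1), of "\<lambda>j. \<xi> $ (inv_into UNIV idx j) * e j x" for x]
    using bij_betw_imp_inj_on[OF assms(1)]
    by (simp add: lincomb_def)
  have "range (lincomb idx e) = range (\<lambda>c x. \<Sum>j=1..2^n. c j * e j x)"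
  proof (intro equalityI image_subsetI)
    show "lincomb idx e \<xi> \<in> range (\<lambda>c x. \<Sum>j=1..2^n. c j * e j x)" for \<xi>
      unfolding ** by (rule rangeI)
    show "(\<lambda>x. \<Sum>j=1..2^n. c j * e j x) \<in> range (lincomb idx e)" for c
      unfolding * by (rule rangeI)
  qed
  then show ?thesis
    using assms(2) by (simp add: spans_PL_def)
qed

lemma lincomb_axis: "lincomb idx e (axis i 1) = e (idx i)"
  by (simp add: lincomb_def axis_def if_distrib[of "\<lambda>a. a * b" for b] cong: if_cong)

lemma deriv_lincomb_mid:
  assumes "\<And>i. e (idx i) \<in> PL n" and "j \<in> {1..2^n}"
  shows "deriv (lincomb idx e \<xi>) (mid n j) = (\<Sum>i\<in>UNIV. \<xi> $ i * deriv (e (idx i)) (mid n j))"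
  unfolding lincomb_def
  by (intro DERIV_imp_deriv DERIV_sum)
    (auto intro!: DERIV_cmult PL_has_derivative_mid assms mid_in_cell)

lemma int_T_lincomb:
  assumes "\<And>i. e (idx i) \<in> PL n"
  shows "int_T (lincomb idx e \<xi>) = (\<Sum>i\<in>UNIV. \<xi> $ i * int_T (e (idx i)))"
  unfolding lincomb_def
  by (subst Bochner_Integration.integral_sum) (auto intro!: integrable_PL assms)

lemma coords_lincomb: "inj (lincomb idx e) \<Longrightarrow> coords idx e (lincomb idx e \<xi>) = \<xi>"
  unfolding coords_def by (rule the_equality) (auto dest: injD)

text \<open>
  A basis \<open>f\<close> of \<open>PL n\<close>, indexed through \<open>idx\<close>, for which the functions \<open>D\<^sub>q f\<^sub>k\<close> are orthonormal in
  \<open>L\<^sup>2\<close>.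
\<close>

locale PL_basis =
  fixes \<epsilon> q :: real and n :: nat and idx :: "'n::finite \<Rightarrow> nat" and f :: "nat \<Rightarrow> real \<Rightarrow> real"
  assumes eps_pos: "0 < \<epsilon>"
    and idx: "bij_betw idx UNIV {1..2^n}"
    and spans: "spans_PL f n"
    and orthonormal: "\<And>i k. inner_f \<epsilon> q (f (idx i)) (f (idx k)) = (if i = k then 1 else 0)"
begin

text \<open>
  The linear parametrization of \<open>PL n\<close> by coordinate vectors.
\<close>

abbreviation F :: "real^'n \<Rightarrow> real \<Rightarrow> real" where
  "F \<equiv> lincomb idx f"

lemma range_F: "range F = PL n"
  by (rule range_lincomb[OF idx spans])

lemma F_PL: "F \<xi> \<in> PL n"
  using range_F by blast

lemma f_PL: "f (idx i) \<in> PL n"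
  by (metis F_PL lincomb_axis)

lemma idx_range: "idx i \<in> {1..2^n}"
  using idx by (auto simp: bij_betw_def)

text \<open>
  The \<open>k\<close>-th column of \<open>R\<close> contains the coordinates of the cellwise constant function \<open>D\<^sub>q f\<^sub>k\<close> with
  respect to the \<open>L\<^sup>2\<close>-orthonormal functions \<open>sqrt N 1\<^sub>K\<close>, where \<open>N = 2^n\<close>.
\<close>

definition R :: "real^'n^'n" where
  "R = (\<chi> i k. Dq \<epsilon> q (f (idx k)) (mid n (idx i)) / sqrt (2^n))"

lemma Dq_F_mid: "Dq \<epsilon> q (F \<xi>) (mid n (idx i)) = sqrt (2^n) * (R *v \<xi>) $ i"
proof -
  have "Dq \<epsilon> q (F \<xi>) (mid n (idx i)) = (\<Sum>k\<in>UNIV. \<xi> $ k * Dq \<epsilon> q (f (idx k)) (mid n (idx i)))"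
    by (simp add: Dq_def deriv_lincomb_mid[where e = f and idx = idx, OF f_PL idx_range]
        int_T_lincomb[where e = f and idx = idx, OF f_PL] sum_distrib_left sum.distrib algebra_simps)
  also have "\<dots> = sqrt (2^n) * (R *v \<xi>) $ i"
    by (simp add: R_def matrix_vector_mult_def sum_distrib_left mult_ac)
  finally show ?thesis .
qed

lemma Dq_f_mid: "Dq \<epsilon> q (f (idx k)) (mid n (idx i)) = sqrt (2^n) * R $ i $ k"
  by (simp add: R_def)

lemma orthogonal_R: "orthogonal_matrix R"
proof -
  have "(transpose R ** R) $ k $ l = inner_f \<epsilon> q (f (idx k)) (f (idx l))" for k l
    unfolding inner_f_def inner_L2_def
    by (subst int_T_cellwise_const_idx[OF idx])
      (auto intro!: cellwise_const_compose2[where \<phi> = "(*)"] cellwise_const_Dq f_PL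
        simp: matrix_matrix_mult_def transpose_def R_def sum_divide_distrib)
  then have "transpose R ** R = mat 1"
    by (simp add: vec_eq_iff orthonormal mat_def)
  then show ?thesis
    by (simp add: orthogonal_matrix)
qed

lemma R_eq_0D: "R *v \<xi> = 0 \<Longrightarrow> \<xi> = 0"
  by (metis orthogonal_R orthogonal_matrix_def matrix_vector_mul_assoc matrix_vector_mul_lid matrix_vector_mult_0_right)

lemma inj_F: "inj F"
proof (rule injI)
  fix x y assume "F x = F y"
  then have "R *v x = R *v y"
    using Dq_F_mid[of x] Dq_F_mid[of y] by (simp add: vec_eq_iff)
  then show "x = y"
    using R_eq_0D[of "x - y"] by (simp add: matrix_vector_mult_diff_distrib)
qed

text \<open>
  Any \<open>N\<close> functions that span \<open>PL n\<close> are linearly independent: the values of \<open>D\<^sub>q\<close> on the cells define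
  a linear endomorphism of the coordinate space, which is surjective because \<open>R\<close> is, hence injective.
\<close>

lemma inj_lincomb:
  assumes "spans_PL e n"
  shows "inj (lincomb idx e)"
proof -
  define A where "A = (\<lambda>\<eta>. \<chi> i. Dq \<epsilon> q (lincomb idx e \<eta>) (mid n (idx i)) :: real^'n)"
  have e: "e (idx i) \<in> PL n" for i
    using range_lincomb[OF idx assms] by (metis rangeI lincomb_axis)
  have "linear A"
    unfolding A_def
    by (rule linearI)
      (simp_all add: vec_eq_iff Dq_def deriv_lincomb_mid[where e = e and idx = idx, OF e idx_range]
        int_T_lincomb[where e = e and idx = idx, OF e]
        sum_distrib_left sum.distrib algebra_simps)
  moreover have "surj A"
  proof (unfold surj_def, intro allI)
    fix y :: "real^'n"
    define \<xi> where "\<xi> = transpose R *v (y /\<^sub>R sqrt (2^n))"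
    have "F \<xi> \<in> range (lincomb idx e)"
      using range_lincomb[OF idx assms] F_PL by simp
    then obtain \<eta> where "F \<xi> = lincomb idx e \<eta>"
      by blast
    then have "A \<eta> = (\<chi> i. sqrt (2^n) * (R *v \<xi>) $ i)"
      by (simp add: A_def Dq_F_mid flip: \<open>F \<xi> = _\<close>)
    also have "R *v \<xi> = y /\<^sub>R sqrt (2^n)"
      using orthogonal_R by (simp only: \<xi>_def matrix_vector_mul_assoc orthogonal_matrix_def matrix_vector_mul_lid)
    finally show "\<exists>\<eta>. y = A \<eta>"
      by (intro exI[of _ \<eta>]) (simp add: vec_eq_iff)
  qed
  ultimately have "inj A"
    by (simp add: linear_surjective_imp_injective)
  then show ?thesis
    by (auto simp: A_def inj_on_def)
qed

end

section \<open>Metrics given by positive definite bilinear forms\<close>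

text \<open>
  The triangle inequality for the norm of an inner product given as a bilinear form, by way of the
  Cauchy-Schwarz inequality.
\<close>

lemma pos_def_form_triangle:
  fixes B :: "'a::real_vector \<Rightarrow> 'a \<Rightarrow> real"
  assumes B: "bilinear B" and sym: "\<And>x y. B x y = B y x" and pos: "\<And>x. x \<noteq> 0 \<Longrightarrow> 0 < B x x"
  shows "sqrt (B (x + y) (x + y)) \<le> sqrt (B x x) + sqrt (B y y)"
proof (cases "y = 0")
  case True
  then show ?thesis
    by (simp add: bilinear_lzero[OF B])
next
  case False
  have nonneg: "0 \<le> B z z" for z
    using pos[of z] by (cases "z = 0") (auto simp: bilinear_lzero[OF B])
  define t where "t = B x y / B y y"
  have ty: "t * B y y = B x y"
    using pos[OF False] by (simp add: t_def)
  have "0 \<le> B (x - t *\<^sub>R y) (x - t *\<^sub>R y)"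
    by (rule nonneg)
  also have "\<dots> = B x x - t * B x y"
    using ty by (simp add: bilinear_lsub[OF B] bilinear_rsub[OF B] bilinear_lmul[OF B] bilinear_rmul[OF B]
        sym[of y x] algebra_simps)
  finally have "t * B x y * B y y \<le> B x x * B y y"
    using pos[OF False] by (intro mult_right_mono) auto
  moreover have "t * B x y * B y y = (B x y)\<^sup>2"
    by (simp add: power2_eq_square flip: ty)
  ultimately have "(B x y)\<^sup>2 \<le> B x x * B y y"
    by simp
  then have "B x y \<le> sqrt (B x x) * sqrt (B y y)"
    by (metis real_le_rsqrt real_sqrt_mult)
  then have "B (x + y) (x + y) \<le> (sqrt (B x x) + sqrt (B y y))\<^sup>2"
    using nonneg by (simp add: bilinear_ladd[OF B] bilinear_radd[OF B] sym[of y x] power2_sum)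
  then show ?thesis
    by (intro real_le_lsqrt) (auto simp: nonneg)
qed

text \<open>
  Equivalence with the Euclidean norm, with the square root of the minimum of the form on the unit
  sphere as lower constant.
\<close>

lemma pos_def_form_norm_equiv:
  fixes B :: "'a::euclidean_space \<Rightarrow> 'a \<Rightarrow> real"
  assumes B: "bilinear B" and pos: "\<And>x. x \<noteq> 0 \<Longrightarrow> 0 < B x x"
  obtains a b where "0 < a" "0 < b"
    "\<And>x. a * norm x \<le> sqrt (B x x)" "\<And>x. sqrt (B x x) \<le> b * norm x"
proof -
  have bb: "bounded_bilinear B"
    using B by (simp add: bilinear_conv_bounded_bilinear)
  obtain b where b: "0 < b" "\<And>x y. norm (B x y) \<le> norm x * norm y * b"
    using bounded_bilinear.pos_bounded[OF bb] by blast
  have "continuous_on (sphere 0 1) (\<lambda>x. B x x)"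
    by (intro bounded_bilinear.continuous_on[OF bb] continuous_on_id)
  moreover have "sphere (0::'a) 1 \<noteq> {}"
    by simp
  ultimately obtain z where z: "z \<in> sphere 0 1" "\<And>x. x \<in> sphere 0 1 \<Longrightarrow> B z z \<le> B x x"
    using continuous_attains_inf[OF compact_sphere] by blast
  have zpos: "0 < B z z"
    using z(1) by (intro pos) auto
  show thesis
  proof
    show "0 < sqrt (B z z)" "0 < sqrt b"
      using zpos b by auto
    fix x
    show "sqrt (B z z) * norm x \<le> sqrt (B x x)"
    proof (cases "x = 0")
      case True
      then show ?thesis by (simp add: bilinear_lzero[OF B])
    next
      case False
      have "B z z \<le> B (x /\<^sub>R norm x) (x /\<^sub>R norm x)"
        using False by (intro z(2)) simp
      also have "\<dots> = B x x / (norm x)\<^sup>2"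
        by (simp add: bilinear_lmul[OF B] bilinear_rmul[OF B] power2_eq_square field_simps)
      finally have "B z z * (norm x)\<^sup>2 \<le> B x x"
        using False by (simp add: field_simps)
      then have "sqrt (B z z * (norm x)\<^sup>2) \<le> sqrt (B x x)"
        by (rule real_sqrt_le_mono)
      then show ?thesis
        by (simp add: real_sqrt_mult)
    qed
    have "B x x \<le> b * (norm x)\<^sup>2"
      using b(2)[of x x] by (simp add: power2_eq_square mult_ac)
    then have "sqrt (B x x) \<le> sqrt (b * (norm x)\<^sup>2)"
      by (rule real_sqrt_le_mono)
    then show "sqrt (B x x) \<le> sqrt b * norm x"
      by (simp add: real_sqrt_mult)
  qed
qed

text \<open>
  If a metric on the range of an injection \<open>F\<close> is, in the coordinates given by \<open>F\<close>, the one of a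
  positive definite bilinear form, then \<open>F\<close> is a homeomorphism from the Euclidean space onto its range.
\<close>

lemma openin_mtopology_pos_def_form:
  fixes B :: "'a::euclidean_space \<Rightarrow> 'a \<Rightarrow> real" and F :: "'a \<Rightarrow> 'b"
  assumes B: "bilinear B" and sym: "\<And>x y. B x y = B y x" and pos: "\<And>x. x \<noteq> 0 \<Longrightarrow> 0 < B x x"
    and nonneg: "\<And>u v. 0 \<le> d u v" and commute: "\<And>u v. d u v = d v u"
    and F: "inj F" and d: "\<And>x y. d (F x) (F y) = sqrt (B (x - y) (x - y))"
  shows "openin (Metric_space.mtopology (range F) d) U \<longleftrightarrow> U \<subseteq> range F \<and> open (F -` U)"
proof -
  have zero: "d u v = 0 \<longleftrightarrow> u = v" if uv: "u \<in> range F" "v \<in> range F" for u v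
  proof -
    obtain x y where xy: "u = F x" "v = F y"
      using uv by blast
    have "B (x - y) (x - y) = 0 \<longleftrightarrow> x - y = 0"
      using pos[of "x - y"] bilinear_lzero[OF B, of "x - y"] by (cases "x - y = 0") auto
    then show ?thesis
      using F by (simp add: xy d inj_eq)
  qed
  have triangle: "d u w \<le> d u v + d v w" if uvw: "u \<in> range F" "v \<in> range F" "w \<in> range F" for u v w
  proof -
    obtain x y z where xyz: "u = F x" "v = F y" "w = F z"
      using uvw by blast
    show ?thesis
      using pos_def_form_triangle[OF B sym pos, of "x - y" "y - z"] by (simp add: xyz d)
  qed
  interpret Metric_space "range F" d
    by (rule Metric_space.intro) (use nonneg commute zero triangle in auto)
  obtain a b where ab: "0 < a" "0 < b"
    "\<And>x. a * norm x \<le> sqrt (B x x)" "\<And>x. sqrt (B x x) \<le> b * norm x"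
    using pos_def_form_norm_equiv[OF B pos] by metis
  show ?thesis
    unfolding openin_mtopology
  proof (intro conj_cong refl iffI)
    assume U: "\<forall>x. x \<in> U \<longrightarrow> (\<exists>r>0. mball x r \<subseteq> U)"
    show "open (F -` U)"
      unfolding open_dist
    proof
      fix x assume "x \<in> F -` U"
      then obtain r where r: "0 < r" "mball (F x) r \<subseteq> U"
        using U by blast
      have "F y \<in> U" if "dist y x < r / b" for y
      proof -
        have "sqrt (B (x - y) (x - y)) \<le> b * dist y x"
          using ab(4)[of "x - y"] by (simp add: dist_norm norm_minus_commute)
        also have "\<dots> < r"
          using that ab by (simp add: field_simps)
        finally have "F y \<in> mball (F x) r"
          by (simp add: d)
        then show ?thesis
          using r by blast
      qed
      then show "\<exists>e>0. \<forall>y. dist y x < e \<longrightarrow> y \<in> F -` U"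
        using r ab by (intro exI[of _ "r / b"]) simp
    qed
  next
    assume U: "U \<subseteq> range F" and op: "open (F -` U)"
    show "\<forall>u. u \<in> U \<longrightarrow> (\<exists>r>0. mball u r \<subseteq> U)"
    proof (intro allI impI)
      fix u assume "u \<in> U"
      then obtain x where x: "u = F x" "x \<in> F -` U"
        using U by blast
      then obtain e where e: "0 < e" "\<And>y. dist y x < e \<Longrightarrow> F y \<in> U"
        using op unfolding open_dist by blast
      have "mball u (a * e) \<subseteq> U"
      proof
        fix v assume v: "v \<in> mball u (a * e)"
        then obtain y where y: "v = F y"
          by auto
        have "a * dist y x \<le> sqrt (B (x - y) (x - y))"
          using ab(3)[of "x - y"] by (simp add: dist_norm norm_minus_commute)
        also have "\<dots> < a * e"
          using v by (simp add: x y d)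
        finally show "v \<in> U"
          using ab e by (simp add: y)
      qed
      then show "\<exists>r>0. mball u r \<subseteq> U"
        using ab e by (intro exI[of _ "a * e"]) simp
    qed
  qed
qed

section \<open>The Borel sets of the space of piecewise linear functions\<close>

text \<open>
  This holds without differentiability: where no derivative exists, \<open>deriv\<close> takes the same unspecified
  value for both functions. It makes \<open>dist_H1\<close> symmetric on all functions.
\<close>

lemma deriv_uminus_square: "(deriv (\<lambda>x. - f x) t)\<^sup>2 = (deriv f t :: real)\<^sup>2"
proof (cases "\<exists>D. DERIV f t :> D")
  case True
  then obtain D where D: "DERIV f t :> D"
    by blast
  show ?thesis
    using DERIV_imp_deriv[OF D] DERIV_imp_deriv[OF DERIV_minus[OF D]] by simp
next
  case False
  moreover have "\<not> (\<exists>D. DERIV (\<lambda>x. - f x) t :> D)"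
    using False DERIV_minus[of "\<lambda>x. - f x"] by fastforce
  ultimately show ?thesis
    by (simp add: deriv_def)
qed

lemma dist_H1_commute: "dist_H1 a b = dist_H1 b a"
proof -
  let ?d = "\<lambda>x. a x - b x"
  have "(\<lambda>x. b x - a x) = (\<lambda>x. - ?d x)"
    by auto
  moreover have "inner_L2 (\<lambda>x. - ?d x) (\<lambda>x. - ?d x) = inner_L2 ?d ?d"
    by (simp only: inner_L2_def power2_eq_square[symmetric] power2_minus)
  moreover have "inner_L2 (deriv (\<lambda>x. - ?d x)) (deriv (\<lambda>x. - ?d x)) = inner_L2 (deriv ?d) (deriv ?d)"
    by (simp only: inner_L2_def power2_eq_square[symmetric] deriv_uminus_square)
  ultimately show ?thesis
    by (simp add: dist_H1_def Let_def)
qed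

lemma inner_L2_nonneg: "0 \<le> inner_L2 h h"
  by (simp add: inner_L2_def)

context PL_basis
begin

text \<open>
  The bilinear form of the \<open>H\<^sup>1\<close> inner product in the coordinates with respect to \<open>f\<close>.
\<close>

definition gram :: "real^'n \<Rightarrow> real^'n \<Rightarrow> real" where
  "gram x y = inner_L2 (F x) (F y) + inner_L2 (deriv (F x)) (deriv (F y))"

lemma dist_H1_F: "dist_H1 (F x) (F y) = sqrt (gram (x - y) (x - y))"
  by (simp add: dist_H1_def gram_def lincomb_diff Let_def)

lemma gram_sym: "gram x y = gram y x"
  by (simp add: gram_def inner_L2_def mult.commute)

lemma inner_L2_deriv_F: "inner_L2 (deriv (F x)) (deriv (F y)) =
    (\<Sum>i\<in>UNIV. deriv (F x) (mid n (idx i)) * deriv (F y) (mid n (idx i))) / 2^n"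
  unfolding inner_L2_def
  by (intro int_T_cellwise_const_idx idx cellwise_const_compose2[where \<phi> = "(*)"]
      cellwise_const_deriv_PL F_PL)

lemma deriv_F_mid: "deriv (F x) (mid n (idx i)) = (\<Sum>k\<in>UNIV. x $ k * deriv (f (idx k)) (mid n (idx i)))"
  by (rule deriv_lincomb_mid[where e = f and idx = idx, OF f_PL idx_range])

lemma bilinear_gram: "bilinear gram"
proof -
  have "linear (\<lambda>x. gram x y)" for y
  proof (rule linearI)
    fix x x' and c :: real
    have "F (x + x') = (\<lambda>t. F x t + F x' t)" "F (c *\<^sub>R x) = (\<lambda>t. c * F x t)"
      by (simp_all add: lincomb_def fun_eq_iff algebra_simps sum.distrib sum_distrib_left)
    then have "inner_L2 (F (x + x')) (F y) = inner_L2 (F x) (F y) + inner_L2 (F x') (F y)"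
      "inner_L2 (F (c *\<^sub>R x)) (F y) = c * inner_L2 (F x) (F y)"
      by (simp_all add: inner_L2_def distrib_right integrable_PL_mult[OF F_PL F_PL] mult.assoc)
    moreover have "deriv (F (x + x')) (mid n (idx i)) = deriv (F x) (mid n (idx i)) + deriv (F x') (mid n (idx i))"
      "deriv (F (c *\<^sub>R x)) (mid n (idx i)) = c * deriv (F x) (mid n (idx i))" for i
      by (simp_all add: deriv_F_mid distrib_right sum.distrib sum_distrib_left mult.assoc)
    ultimately show "gram (x + x') y = gram x y + gram x' y" "gram (c *\<^sub>R x) y = c *\<^sub>R gram x y"
      by (simp_all add: gram_def inner_L2_deriv_F distrib_right distrib_left sum.distrib add_divide_distrib
          sum_distrib_left mult.assoc)
  qed
  then show ?thesis
    unfolding bilinear_def by (auto simp: gram_sym[of x for x])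
qed

lemma gram_pos_def:
  assumes "x \<noteq> 0" shows "0 < gram x x"
proof (rule ccontr)
  assume "\<not> 0 < gram x x"
  then have 0: "inner_L2 (F x) (F x) = 0" "inner_L2 (deriv (F x)) (deriv (F x)) = 0"
    using inner_L2_nonneg[of "F x"] inner_L2_nonneg[of "deriv (F x)"] by (auto simp: gram_def)
  \<comment> \<open>Then \<open>F x\<close> has mean zero and vanishing derivative, hence \<open>D\<^sub>q (F x) = 0\<close>.\<close>
  have "AE t in lebesgue_on {0..1}. F x t * F x t = 0"
    using 0(1) integral_nonneg_eq_0_iff_AE[OF integrable_PL_mult[OF F_PL F_PL], of x x]
    by (simp add: inner_L2_def)
  then have "int_T (F x) = int_T (\<lambda>_. 0)"
    using integrable_PL[OF F_PL, of x] by (intro integral_cong_AE) auto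
  moreover have "deriv (F x) (mid n (idx i)) = 0" for i
    using 0(2) by (simp add: inner_L2_deriv_F sum_nonneg_eq_0_iff)
  ultimately have "R *v x = 0"
    using Dq_F_mid[of x] by (simp add: Dq_def vec_eq_iff)
  then show False
    using R_eq_0D assms by blast
qed

lemma openin_PL:
  "openin (Metric_space.mtopology (PL n) dist_H1) U \<longleftrightarrow> U \<subseteq> PL n \<and> open (F -` U)"
  unfolding range_F[symmetric]
proof (rule openin_mtopology_pos_def_form[OF bilinear_gram gram_sym gram_pos_def])
  show "0 \<le> dist_H1 u v" for u v
    by (simp add: dist_H1_def Let_def inner_L2_nonneg)
qed (use dist_H1_commute inj_F dist_H1_F in auto)

lemma measurable_F: "F \<in> borel \<rightarrow>\<^sub>M borel_PL n"
  unfolding borel_PL_def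
proof (rule measurable_measure_of)
  show "F -` U \<inter> space borel \<in> sets borel"
    if "U \<in> {U. openin (Metric_space.mtopology (PL n) dist_H1) U}" for U
    using that by (auto simp: openin_PL)
qed (use F_PL in \<open>auto simp: openin_PL\<close>)

lemma measurable_coords: "coords idx f \<in> borel_PL n \<rightarrow>\<^sub>M borel"
proof (rule borel_measurableI)
  fix S :: "(real^'n) set" assume "open S"
  have PL: "space (borel_PL n) = PL n"
    by (simp add: borel_PL_def space_measure_of_conv)
  have vim: "F -` (coords idx f -` S \<inter> PL n) = S"
    using F_PL by (auto simp: coords_lincomb[OF inj_F])
  then have "coords idx f -` S \<inter> PL n \<in> {U. openin (Metric_space.mtopology (PL n) dist_H1) U}"
    using \<open>open S\<close> by (simp add: openin_PL vim)
  then show "coords idx f -` S \<inter> space (borel_PL n) \<in> sets (borel_PL n)"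
    unfolding PL unfolding borel_PL_def
    by (subst sets_measure_of) (auto simp: openin_PL intro: sigma_sets.Basic)
qed

text \<open>
  The coordinates of the random function \<open>F (X \<omega>)\<close> are \<open>X \<omega>\<close>, so they have the same density.
\<close>

lemma distributed_coords:
  assumes "distributed \<Omega> lborel X p"
  shows "distributed (distr \<Omega> (borel_PL n) (\<lambda>\<omega>. F (X \<omega>))) lborel (coords idx f) p"
proof -
  have X: "X \<in> \<Omega> \<rightarrow>\<^sub>M borel"
    using assms by (simp add: distributed_def)
  have "distr (distr \<Omega> (borel_PL n) (\<lambda>\<omega>. F (X \<omega>))) lborel (coords idx f) = distr \<Omega> lborel X"
    using measurable_coords measurable_compose[OF X measurable_F]
    by (subst distr_distr) (simp_all add: comp_def coords_lincomb[OF inj_F])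
  then show ?thesis
    using assms measurable_coords by (simp add: distributed_def)
qed

section \<open>Covariance matrix and density\<close>

text \<open>
  The value of \<open>\<epsilon>\<^sup>2 + (Q\<^sub>n v)\<^sup>2\<close> on the \<open>i\<close>-th cell.
\<close>

definition cell_weight :: "(real \<Rightarrow> real) \<Rightarrow> 'n \<Rightarrow> real" where
  "cell_weight v i = \<epsilon>\<^sup>2 + (Qn n v (mid n (idx i)))\<^sup>2"

lemma cell_weight_pos: "0 < cell_weight v i"
  using eps_pos by (simp add: cell_weight_def add_pos_nonneg)

lemma Cmat_eq: "Cmat \<epsilon> q idx f n v = conj_diag R (\<lambda>i. inverse (cell_weight v i))"
proof -
  have "inner_L2 (Lambda \<epsilon> n v (Dq \<epsilon> q (f (idx j)))) (Dq \<epsilon> q (f (idx k))) =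
     (\<Sum>i\<in>UNIV. R $ i $ j * inverse (cell_weight v i) * R $ i $ k)" for j k
  proof -
    have "cellwise_const n (Lambda \<epsilon> n v (Dq \<epsilon> q (f (idx j))))"
      unfolding Lambda_def
      by (rule cellwise_const_compose2[where \<phi> = "\<lambda>a b. inverse (\<epsilon>\<^sup>2 + a\<^sup>2) * b"])
        (intro cellwise_const_Qn cellwise_const_Dq f_PL)+
    then have "inner_L2 (Lambda \<epsilon> n v (Dq \<epsilon> q (f (idx j)))) (Dq \<epsilon> q (f (idx k))) =
      (\<Sum>i\<in>UNIV. Lambda \<epsilon> n v (Dq \<epsilon> q (f (idx j))) (mid n (idx i)) *
        Dq \<epsilon> q (f (idx k)) (mid n (idx i))) / 2^n"
      unfolding inner_L2_def
      by (intro int_T_cellwise_const_idx idx cellwise_const_compose2[where \<phi> = "(*)"]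
          cellwise_const_Dq f_PL)
    also have "\<dots> = (\<Sum>i\<in>UNIV. R $ i $ j * inverse (cell_weight v i) * R $ i $ k)"
    proof -
      have sqrt2: "sqrt (2^n) * (sqrt (2^n) * a) / (2^n * b) = a / b" for a b :: real
        by (simp add: mult.assoc[symmetric])
      show ?thesis
        unfolding sum_divide_distrib
        by (intro sum.cong refl)
          (simp add: Lambda_def cell_weight_def[symmetric] Dq_f_mid field_simps sqrt2)
    qed
    finally show ?thesis .
  qed
  then show ?thesis
    by (simp add: Cmat_def conj_diag_def vec_eq_iff matrix_mul_diag_mat_right
        matrix_matrix_mult_def[of "_ ** _" R] transpose_def)
qed

lemma int_T_exponent:
  "int_T (\<lambda>x. - (2^n) * ln (\<epsilon>\<^sup>2 + (Qn n v x)\<^sup>2) + (\<epsilon>\<^sup>2 + (Qn n v x)\<^sup>2) * \<bar>Dq \<epsilon> q (F \<xi>) x\<bar>\<^sup>2) =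
   (\<Sum>i\<in>UNIV. - ln (cell_weight v i) + cell_weight v i * ((R *v \<xi>) $ i)\<^sup>2)"
proof -
  have "int_T (\<lambda>x. - (2^n) * ln (\<epsilon>\<^sup>2 + (Qn n v x)\<^sup>2) + (\<epsilon>\<^sup>2 + (Qn n v x)\<^sup>2) * \<bar>Dq \<epsilon> q (F \<xi>) x\<bar>\<^sup>2) =
    (\<Sum>i\<in>UNIV. - (2^n) * ln (cell_weight v i) +
      cell_weight v i * \<bar>Dq \<epsilon> q (F \<xi>) (mid n (idx i))\<bar>\<^sup>2) / 2^n"
    unfolding cell_weight_def
    by (intro int_T_cellwise_const_idx idx
        cellwise_const_compose2[where a = "Qn n v" and b = "Dq \<epsilon> q (F \<xi>)" and
          \<phi> = "\<lambda>a b. - (2^n) * ln (\<epsilon>\<^sup>2 + a\<^sup>2) + (\<epsilon>\<^sup>2 + a\<^sup>2) * \<bar>b\<bar>\<^sup>2"]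
        cellwise_const_Qn cellwise_const_Dq F_PL)
  also have "\<dots> = (\<Sum>i\<in>UNIV. - ln (cell_weight v i) + cell_weight v i * ((R *v \<xi>) $ i)\<^sup>2)"
    unfolding sum_divide_distrib
    by (intro sum.cong refl) (simp add: Dq_F_mid power_mult_distrib diff_divide_distrib)
  finally show ?thesis .
qed

end

theorem theorem3:
  fixes \<epsilon> q :: real and f g :: "nat \<Rightarrow> real \<Rightarrow> real" and n :: nat
    and idx :: "'n::finite \<Rightarrow> nat" and \<Omega> :: "'w measure" and W :: "'w \<Rightarrow> real^'n"
  assumes "\<epsilon> > 0" and "q > 1"
    and "orthonormal_basis_H1 (inner_g \<epsilon>) g" and "\<And>m. spans_PL g m"
    and "orthonormal_basis_H1 (inner_f \<epsilon> q) f" and "\<And>m. spans_PL f m"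
    and "bij_betw idx UNIV {1..2^n}"
    and "gaussian_vector \<Omega> W 0 (mat 1)"
  shows "\<exists>(\<rho> :: real^'n \<Rightarrow> real^'n \<Rightarrow> real) c. c > 0 \<and>
    (\<forall>v\<in>PL n. distributed (prior_cond \<Omega> W \<epsilon> q idx f n v) lborel (coords idx f)
                 (\<lambda>\<xi>. ennreal (\<rho> \<xi> (coords idx g v)))) \<and>
    (\<forall>u\<in>PL n. \<forall>v\<in>PL n. \<rho> (coords idx f u) (coords idx g v) =
       c * exp (- (1/2) * int_T (\<lambda>x.
             - (2^n) * ln (\<epsilon>\<^sup>2 + (Qn n v x)\<^sup>2) + (\<epsilon>\<^sup>2 + (Qn n v x)\<^sup>2) * \<bar>Dq \<epsilon> q u x\<bar>\<^sup>2)))"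
proof -
  have idx_ge: "1 \<le> idx i" for i
    using assms(7) by (auto simp: bij_betw_def)
  interpret PL_basis \<epsilon> q n idx f
  proof
    show "inner_f \<epsilon> q (f (idx i)) (f (idx k)) = (if i = k then 1 else 0)" for i k
      using assms(5) idx_ge bij_betw_imp_inj_on[OF assms(7)]
      by (simp add: orthonormal_basis_H1_def inj_eq)
  qed (use assms in auto)
  have inj_g: "inj (lincomb idx g)"
    by (rule inj_lincomb) (rule assms(4))
  have g_coords: "lincomb idx g (coords idx g v) = v" if "v \<in> PL n" for v
    using that range_lincomb[OF assms(7) assms(4)] coords_lincomb[OF inj_g] by (metis rangeE)
  define c where "c = 1 / sqrt ((2 * pi) ^ CARD('n))"
  \<comment> \<open>The density has to be a function of the coordinates of \<open>v\<close>, from which \<open>v\<close> is recovered.\<close>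
  define \<rho> where "\<rho> \<xi> \<eta> = c * exp (- (1/2) * (\<Sum>i\<in>UNIV. - ln (cell_weight (lincomb idx g \<eta>) i) +
      cell_weight (lincomb idx g \<eta>) i * ((R *v \<xi>) $ i)\<^sup>2))" for \<xi> \<eta>
  show ?thesis
  proof (intro exI conjI ballI)
    show "0 < c"
      by (simp add: c_def)
    fix v assume v: "v \<in> PL n"
    show "distributed (prior_cond \<Omega> W \<epsilon> q idx f n v) lborel (coords idx f)
        (\<lambda>\<xi>. ennreal (\<rho> \<xi> (coords idx g v)))"
      unfolding prior_cond_def Cmat_eq \<rho>_def c_def g_coords[OF v]
      by (intro distributed_coords distributed_psd_sqrt_gaussian assms(8) orthogonal_R cell_weight_pos)
  next
    fix u v assume u: "u \<in> PL n" and v: "v \<in> PL n"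
    obtain \<xi> where u_eq: "u = F \<xi>"
      using u range_F by blast
    show "\<rho> (coords idx f u) (coords idx g v) =
       c * exp (- (1/2) * int_T (\<lambda>x.
             - (2^n) * ln (\<epsilon>\<^sup>2 + (Qn n v x)\<^sup>2) + (\<epsilon>\<^sup>2 + (Qn n v x)\<^sup>2) * \<bar>Dq \<epsilon> q u x\<bar>\<^sup>2))"
      unfolding u_eq int_T_exponent by (simp add: \<rho>_def g_coords[OF v] coords_lincomb[OF inj_F])
  qed
qed

end
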